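(* Let $k\ge1$, $\Gamma=\mathbb{Z}^k$, and let $G$, $\mathcal{T}(\Gamma,G;\mathbb{R}^{k+1})$, $\Psi_1,\Psi_2$ be as defined in the context. Let $D_1$ be the set of $(\vec x,\,{}^t(\vec\eta_1,\dots,\vec\eta_k),\,\vec z)\in\mathbb{R}^k\oplus M(k,\mathbb{R})\oplus\mathbb{R}^k$ such that 1) $\vec z\ne\vec 0$, 2) $\vec\eta_j\perp\vec z$ for $1\le j\le k$, 3) $\operatorname{rank}(\vec\eta_1,\dots,\vec\eta_k)=k-1$, and let $D_2$ be the set of $(X,Y)\in M(k,\mathbb{R})\oplus M(k,\mathbb{R})$ such that 1) $\operatorname{Trace}(X\,{}^tY)=0$, 2) $\det(Y-\lambda X)\ne0$ for any $\lambda\in\mathbb{R}$. For $i=1,2$ let $\overline{\Psi}_i$ be the composition of $\Psi_i$ (which maps into $R(\Gamma,G;\mathbb{R}^{k+1})$ on the set $M_i^r\supset D_i$ defined in the context) with the quotient map $R(\Gamma,G;\mathbb{R}^{k+1})\to\mathcal{T}(\Gamma,G;\mathbb{R}^{k+1})$. Then $\overline\Psi_1$ and $\overline\Psi_2$ induce a bijection from the disjoint union $$\overline\Psi_1\cup\overline\Psi_2:\ D_1\cup D_2\ \longrightarrow\ \mathcal{T}(\Gamma,G;\mathbb{R}^{k+1}).$$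
   Context: $M(k,\mathbb{R})$ is the set of real $k\times k$ matrices; ${}^t(\vec\eta_1,\dots,\vec\eta_k)$ is the matrix whose $j$th row is ${}^t\vec\eta_j$; $\perp$ is with respect to the standard inner product. $G$ is the group of real $(k+2)\times(k+2)$ matrices $\begin{pmatrix} I_k&\vec x&\vec y\\0&1&z\\0&0&1\end{pmatrix}$ with $\vec x,\vec y\in\mathbb{R}^k$, $z\in\mathbb{R}$, and $H\subset G$ is the subgroup with $\vec y=\vec 0$, $z=0$. The homogeneous space $G/H$ is identified with $\mathbb{R}^{k+1}$; $G$ acts on $\mathbb{R}^{k+1}=\mathbb{R}^k\oplus\mathbb{R}$ by the affine maps $(\vec\xi,\xi_{k+1})\mapsto(\vec\xi+\xi_{k+1}\vec x+\vec y,\ \xi_{k+1}+z)$, and $H$ is the stabilizer of the origin. $e_1,\dots,e_k$ is the standard basis of $\Gamma=\mathbb{Z}^k$. $\operatorname{Hom}(\Gamma,G)$ is the set of group homomorphisms, regarded as a subset of $G\times\cdots\times G$ ($k$ factors) via $\varphi\mapsto(\varphi(e_1),\dots,\varphi(e_k))$. $R(\Gamma,G;\mathbb{R}^{k+1})$ is the set of $\varphi\in\operatorname{Hom}(\Gamma,G)$ such that $\varphi$ is injective and $\varphi(\Gamma)$ acts properly discontinuously and freely on $\mathbb{R}^{k+1}$ (properly discontinuous: for every compact $S\subset\mathbb{R}^{k+1}$ the set $\{\gamma\in\varphi(\Gamma):\gamma S\cap S\ne\emptyset\}$ is finite). $G$ acts on $R(\Gamma,G;\mathbb{R}^{k+1})$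 by conjugation, $(h\cdot\varphi)(\gamma)=h\varphi(\gamma)h^{-1}$, and the deformation space is the quotient set $\mathcal{T}(\Gamma,G;\mathbb{R}^{k+1})=R(\Gamma,G;\mathbb{R}^{k+1})/G$. For $\vec x,\vec y\in\mathbb{R}^k$, $z\in\mathbb{R}$ put $g(\vec x,\vec y,z)=\exp\begin{pmatrix}0_k&\vec x&\vec y\\0&0&z\\0&0&0\end{pmatrix}=\begin{pmatrix}I_k&\vec x&\vec y+\frac12 z\vec x\\0&1&z\\0&0&1\end{pmatrix}\in G$. With $\vec y_j$ (resp. $\vec x_j$) the $j$th column of $Y$ (resp. $X$) and $\vec z={}^t(z_1,\dots,z_k)$, define $$\Psi_1(\vec x,Y,\vec z)=\bigl(g(z_j\vec x,\vec y_j,z_j)\bigr)_{1\le j\le k},\qquad \Psi_2(X,Y)=\bigl(g(\vec x_j,\vec y_j,0)\bigr)_{1\le j\le k}.$$ Set $M_1^r=\{(\vec x,Y,\vec z): \vec z\neq \vec 0,\ \operatorname{rank}({}^tY,\vec z)=k\}$ (where $({}^tY,\vec z)$ is a $k\times(k+1)$ matrix) and $M_2^r=\{(X,Y):\det(Y-\lambda X)\neq 0\ \text{for any } \lambda\in\mathbb{R}\}$. *)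

theory Defs
  imports "HOL-Analysis.Analysis" "HOL-Algebra.Group"
begin

text \<open>The index type \<^typ>\<open>'k\<close> plays the role of \<open>{1, ..., k}\<close>, so \<open>k = CARD('k) \<ge> 1\<close>.
  Square matrices of size \<open>k + 2\<close> are indexed by the sum type \<open>'k + 2\<close>:
  \<open>Inl i\<close> is position \<open>i\<close>, \<open>Inr 0\<close> is position \<open>k + 1\<close> and \<open>Inr 1\<close> is position \<open>k + 2\<close>.\<close>

type_synonym 'k gmat = "real ^ ('k + 2) ^ ('k + 2)"

definition block :: "real ^ 'k \<Rightarrow> real ^ 'k \<Rightarrow> real \<Rightarrow> real \<Rightarrow> 'k gmat" where
  "block x y z d = (\<chi> a b.
     case a of
       Inl i \<Rightarrow> (case b of Inl j \<Rightarrow> (if i = j then d else 0) | Inr c \<Rightarrow> (if c = 0 then x $ i else y $ i))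
     | Inr r \<Rightarrow> (case b of Inl j \<Rightarrow> 0 | Inr c \<Rightarrow> (if r = c then d else if r = 0 then z else 0)))"

text \<open>The last argument of \<^const>\<open>block\<close> is the common diagonal entry: it is \<open>1\<close> for elements of
  the group and \<open>0\<close> for elements of its Lie algebra.\<close>

definition GG :: "('k::finite) gmat monoid" where
  "GG = \<lparr>carrier = {block x y z 1 | x y z. True}, mult = (**), one = mat 1\<rparr>"

definition act :: "('k::finite) gmat \<Rightarrow> (real ^ 'k) \<times> real \<Rightarrow> (real ^ 'k) \<times> real" where
  "act g = (\<lambda>(\<xi>, s).
     (\<chi> i. \<xi> $ i + s * g $ Inl i $ Inr 0 + g $ Inl i $ Inr 1, s + g $ Inr 0 $ Inr 1))"

definition Zk :: "(int ^ 'k::finite) monoid" where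
  "Zk = \<lparr>carrier = UNIV, mult = (+), one = 0\<rparr>"

definition properly_discontinuous :: "('k::finite) gmat set \<Rightarrow> bool" where
  "properly_discontinuous L \<longleftrightarrow>
     (\<forall>S. compact S \<longrightarrow> finite {\<gamma> \<in> L. act \<gamma> ` S \<inter> S \<noteq> {}})"

definition acts_freely :: "('k::finite) gmat set \<Rightarrow> bool" where
  "acts_freely L \<longleftrightarrow> (\<forall>\<gamma>\<in>L. \<forall>p. act \<gamma> p = p \<longrightarrow> \<gamma> = mat 1)"

definition RR :: "(int ^ 'k \<Rightarrow> ('k::finite) gmat) set" where
  "RR = {\<phi> \<in> hom Zk GG. inj \<phi> \<and> properly_discontinuous (range \<phi>) \<and> acts_freely (range \<phi>)}"

definition conjugate :: "('k::finite) gmat \<Rightarrow> (int ^ 'k \<Rightarrow> 'k gmat) \<Rightarrow> (int ^ 'k \<Rightarrow> 'k gmat)" where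
  "conjugate h \<phi> = (\<lambda>\<gamma>. h \<otimes>\<^bsub>GG\<^esub> \<phi> \<gamma> \<otimes>\<^bsub>GG\<^esub> inv\<^bsub>GG\<^esub> h)"

definition conj_rel :: "((int ^ 'k \<Rightarrow> ('k::finite) gmat) \<times> (int ^ 'k \<Rightarrow> 'k gmat)) set" where
  "conj_rel = {(\<phi>, \<psi>). \<phi> \<in> RR \<and> \<psi> \<in> RR \<and> (\<exists>h \<in> carrier GG. \<psi> = conjugate h \<phi>)}"

definition TT :: "(int ^ 'k \<Rightarrow> ('k::finite) gmat) set set" where
  "TT = RR // conj_rel"

definition qmap :: "(int ^ 'k \<Rightarrow> ('k::finite) gmat) \<Rightarrow> (int ^ 'k \<Rightarrow> 'k gmat) set" where
  "qmap \<phi> = conj_rel `` {\<phi>}"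

definition ev :: "(int ^ 'k \<Rightarrow> ('k::finite) gmat) \<Rightarrow> 'k gmat ^ 'k" where
  "ev \<phi> = (\<chi> j. \<phi> (axis j 1))"

text \<open>The closed form of the matrix exponential of \<open>block x y z 0\<close>; see \<open>gexp_exponential\<close> below.\<close>

definition gexp :: "real ^ 'k \<Rightarrow> real ^ 'k \<Rightarrow> real \<Rightarrow> ('k::finite) gmat" where
  "gexp x y z = block x (y + (z / 2) *\<^sub>R x) z 1"

definition Psi1 :: "(real ^ 'k) \<times> (real ^ 'k ^ 'k) \<times> (real ^ 'k) \<Rightarrow> ('k::finite) gmat ^ 'k" where
  "Psi1 = (\<lambda>(x, Y, z). \<chi> j. gexp (z $ j *\<^sub>R x) (column j Y) (z $ j))"

definition Psi2 :: "(real ^ 'k ^ 'k) \<times> (real ^ 'k ^ 'k) \<Rightarrow> ('k::finite) gmat ^ 'k" where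
  "Psi2 = (\<lambda>(X, Y). \<chi> j. gexp (column j X) (column j Y) 0)"

definition append_column :: "real ^ 'k ^ 'k \<Rightarrow> real ^ 'k \<Rightarrow> real ^ ('k + 1) ^ 'k" where
  "append_column A z = (\<chi> i c. case c of Inl j \<Rightarrow> A $ i $ j | Inr _ \<Rightarrow> z $ i)"

definition M1r :: "((real ^ 'k) \<times> (real ^ 'k ^ 'k) \<times> (real ^ 'k::finite)) set" where
  "M1r = {(x, Y, z). z \<noteq> 0 \<and> rank (append_column (transpose Y) z) = CARD('k)}"

definition M2r :: "((real ^ 'k ^ 'k) \<times> (real ^ 'k ^ 'k::finite)) set" where
  "M2r = {(X, Y). \<forall>l::real. det (Y - l *\<^sub>R X) \<noteq> 0}"

definition D1 :: "((real ^ 'k) \<times> (real ^ 'k ^ 'k) \<times> (real ^ 'k::finite)) set" where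
  "D1 = {(x, Y, z). z \<noteq> 0 \<and> (\<forall>j. orthogonal (row j Y) z) \<and> rank (transpose Y) = CARD('k) - 1}"

definition D2 :: "((real ^ 'k ^ 'k) \<times> (real ^ 'k ^ 'k::finite)) set" where
  "D2 = {(X, Y). trace (X ** transpose Y) = 0 \<and> (\<forall>l::real. det (Y - l *\<^sub>R X) \<noteq> 0)}"

text \<open>A tuple in the range of \<^const>\<open>ev\<close> on \<^term>\<open>hom Zk GG\<close> is identified with the unique
  homomorphism it comes from (uniqueness: \<open>inj_on_ev\<close> below).\<close>

definition hom_of :: "('k::finite) gmat ^ 'k \<Rightarrow> (int ^ 'k \<Rightarrow> 'k gmat)" where
  "hom_of = inv_into (hom Zk GG) ev"

definition Psi1_bar ::
  "(real ^ 'k) \<times> (real ^ 'k ^ 'k) \<times> (real ^ 'k) \<Rightarrow> (int ^ 'k \<Rightarrow> ('k::finite) gmat) set" where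
  "Psi1_bar p = qmap (hom_of (Psi1 p))"

definition Psi2_bar ::
  "(real ^ 'k ^ 'k) \<times> (real ^ 'k ^ 'k) \<Rightarrow> (int ^ 'k \<Rightarrow> ('k::finite) gmat) set" where
  "Psi2_bar p = qmap (hom_of (Psi2 p))"


lemma UNIV_2': "(UNIV :: 2 set) = {0, 1}"
proof -
  have "card {0, 1 :: 2} = CARD(2)" by simp
  then show ?thesis by (metis card_subset_eq finite subset_UNIV)
qed

lemma all_2': "(\<forall>c :: 2. P c) \<longleftrightarrow> P 0 \<and> P 1"
  by (metis UNIV_2' UNIV_I empty_iff insert_iff)

lemma sum_sum2: "(\<Sum>c\<in>(UNIV :: ('k::finite + 2) set). f c) =
    (\<Sum>i\<in>UNIV. f (Inl i)) + f (Inr 0) + (f (Inr 1) :: real)"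
  by (simp add: UNIV_Plus_UNIV[symmetric] sum.Plus UNIV_2' del: UNIV_Plus_UNIV)

lemma all_sum2: "(\<forall>c :: 'k + 2. P c) \<longleftrightarrow> (\<forall>i. P (Inl i)) \<and> P (Inr 0) \<and> P (Inr 1)"
  by (auto simp: all_2' split_sum_all)

lemma block_nth:
  "block x y z d $ Inl i $ Inl j = (if i = j then d else 0)"
  "block x y z d $ Inl i $ Inr 0 = x $ i"
  "block x y z d $ Inl i $ Inr 1 = y $ i"
  "block x y z d $ Inr r $ Inl j = 0"
  "block x y z d $ Inr 0 $ Inr 0 = d"
  "block x y z d $ Inr 0 $ Inr 1 = z"
  "block x y z d $ Inr 1 $ Inr 0 = 0"
  "block x y z d $ Inr 1 $ Inr 1 = d"
  by (simp_all add: block_def)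

lemma gmat_eq_iff: "(A :: ('k::finite) gmat) = B \<longleftrightarrow> (\<forall>a b. A $ a $ b = B $ a $ b)"
  by (simp add: vec_eq_iff)

lemma block_mult:
  "block x y z d ** block x' y' z' d' =
   block (d *\<^sub>R x' + d' *\<^sub>R x) (d *\<^sub>R y' + z' *\<^sub>R x + d' *\<^sub>R y) (d * z' + z * d') (d * d')"
  by (simp add: gmat_eq_iff matrix_matrix_mult_def all_sum2 sum_sum2 block_nth
      if_distrib if_distribR sum.delta cong: if_cong)

lemma mat_1_block: "(mat 1 :: ('k::finite) gmat) = block 0 0 0 1"
  by (simp add: gmat_eq_iff all_sum2 block_nth mat_def)

lemma block_inject:
  "block x y z d = block x' y' z' d' \<longleftrightarrow> x = x' \<and> y = y' \<and> z = z' \<and> d = d'"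
  by (auto simp: gmat_eq_iff all_sum2 block_nth vec_eq_iff)

lemma carrier_GG_iff: "g \<in> carrier GG \<longleftrightarrow> (\<exists>x y z. g = block x y z 1)"
  by (simp add: GG_def)

lemma group_GG: "group (GG :: ('k::finite) gmat monoid)"
proof (rule groupI)
  fix g h :: "'k gmat" assume "g \<in> carrier GG" "h \<in> carrier GG"
  then obtain x y z x' y' z' where "g = block x y z 1" "h = block x' y' z' 1"
    unfolding carrier_GG_iff by blast
  then have "g ** h = block (x' + x) (y' + z' *\<^sub>R x + y) (z' + z) 1"
    by (simp add: block_mult)
  then show "g \<otimes>\<^bsub>GG\<^esub> h \<in> carrier GG"
    unfolding carrier_GG_iff by (simp add: GG_def) blast
next
  fix g :: "'k gmat" assume "g \<in> carrier GG"
  then obtain x y z where g: "g = block x y z 1" unfolding carrier_GG_iff by blast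
  have "block (- x) (z *\<^sub>R x - y) (- z) 1 \<otimes>\<^bsub>GG\<^esub> g = \<one>\<^bsub>GG\<^esub>"
    by (simp add: GG_def g block_mult mat_1_block)
  then show "\<exists>h\<in>carrier GG. h \<otimes>\<^bsub>GG\<^esub> g = \<one>\<^bsub>GG\<^esub>"
    unfolding carrier_GG_iff Bex_def by blast
next
  show "\<one>\<^bsub>GG\<^esub> \<in> carrier (GG :: 'k gmat monoid)"
    unfolding carrier_GG_iff by (simp add: GG_def mat_1_block) blast
qed (simp_all add: GG_def matrix_mul_assoc)

lemma act_block: "act (block x y z 1) (\<xi>, s) = (\<xi> + s *\<^sub>R x + y, s + z)"
  by (simp add: act_def block_nth vec_eq_iff)

lemma act_mult:
  assumes "g \<in> carrier GG" "h \<in> carrier GG"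
  shows "act (g \<otimes>\<^bsub>GG\<^esub> h) p = act g (act h p)"
  using assms by (cases p) (auto simp: GG_def block_mult act_block algebra_simps)

lemma stabilizer_origin: "{g \<in> carrier GG. act g 0 = 0} = {block x 0 0 1 | x. True}"
  by (auto simp: GG_def act_block zero_prod_def)

lemma gexp_exponential:
  "(\<lambda>n. (1 / fact n) *\<^sub>R (((**) (block x y z 0)) ^^ n) (mat 1)) sums gexp x y z"
proof -
  let ?f = "\<lambda>n. (1 / fact n) *\<^sub>R (((**) (block x y z 0)) ^^ n) (mat 1)"
  have z0: "block 0 0 0 0 = (0 :: 'a gmat)"
    by (simp add: gmat_eq_iff all_sum2 block_nth)
  have p: "(((**) (block x y z 0)) ^^ (n + 3)) (mat 1) = 0" for n
    by (induction n) (simp_all add: numeral_3_eq_3 mat_1_block block_mult z0)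
  have "?f n = 0" if "n \<notin> {..<3}" for n
    using p[of "n - 3"] that by simp
  then have "?f sums (\<Sum>n<3. ?f n)"
    by (intro sums_finite) auto
  also have "(\<Sum>n<3. ?f n) = gexp x y z"
    by (simp add: numeral_3_eq_3 mat_1_block block_mult gexp_def)
       (simp add: gmat_eq_iff all_sum2 block_nth)
  finally show ?thesis .
qed

lemma inj_on_ev: "inj_on ev (hom (Zk :: (int ^ 'k::finite) monoid) GG)"
proof (rule inj_onI)
  interpret G: group "GG :: 'k gmat monoid" by (rule group_GG)
  have Z: "group (Zk :: (int ^ 'k) monoid)"
    by (rule groupI) (simp_all add: Zk_def add.assoc, metis left_minus)
  fix \<phi> \<psi> :: "int ^ 'k \<Rightarrow> 'k gmat"
  assume h: "\<phi> \<in> hom Zk GG" "\<psi> \<in> hom Zk GG" and e: "ev \<phi> = ev \<psi>"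
  let ?P = "\<lambda>v. \<phi> v = \<psi> v"
  have add: "\<phi> (v + w) = \<phi> v \<otimes>\<^bsub>GG\<^esub> \<phi> w" "\<psi> (v + w) = \<psi> v \<otimes>\<^bsub>GG\<^esub> \<psi> w" for v w
    using h by (auto simp: hom_def Zk_def)
  have c: "\<phi> v \<in> carrier GG" "\<psi> v \<in> carrier GG" for v
    using h by (auto simp: hom_def Zk_def)
  have P0: "?P 0"
    using hom_one[OF h(1) Z group_GG] hom_one[OF h(2) Z group_GG] by (simp add: Zk_def)
  have Pd: "?P (v + w)" if "?P v" "?P w" for v w
    using that by (simp add: add)
  have Pm: "?P (- v)" if "?P v" for v
  proof -
    have "\<phi> (- v) \<otimes>\<^bsub>GG\<^esub> \<phi> v = \<psi> (- v) \<otimes>\<^bsub>GG\<^esub> \<phi> v"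
      using add[of "- v" v] P0 that by simp
    then show ?thesis using c by (simp add: G.right_cancel)
  qed
  have Pa: "?P (axis j 1)" for j
    using e by (simp add: ev_def vec_eq_iff)
  have Pn: "?P (axis j (int n))" for j n
  proof (induction n)
    case 0
    have "axis j (0::int) = 0" by (simp add: axis_def vec_eq_iff)
    then show ?case using P0 by (metis of_nat_0)
  next
    case (Suc n)
    have "axis j (int (Suc n)) = axis j 1 + axis j (int n)"
      by (simp add: axis_def vec_eq_iff)
    then show ?case using Pd[OF Pa Suc] by simp
  qed
  have Pz: "?P (axis j m)" for j m
  proof (cases m rule: int_cases2)
    case (nonneg n) then show ?thesis using Pn by simp
  next
    case (nonpos n)
    have "axis j (- int n) = - axis j (int n)" by (simp add: axis_def vec_eq_iff)
    then show ?thesis using Pm[OF Pn] nonpos by simp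
  qed
  have Ps: "?P (\<Sum>j\<in>J. axis j (v $ j))" if "finite J" for J v
    using that by (induction J) (use P0 Pz Pd in auto)
  have "(\<Sum>j\<in>UNIV. axis j (v $ j)) = v" for v :: "int ^ 'k"
    by (simp add: vec_eq_iff axis_def sum.delta)
  then have "\<phi> v = \<psi> v" for v
    using Ps[of UNIV v] by simp
  then show "\<phi> = \<psi>" by (rule ext)
qed

end

theory Submission
  imports Defs
begin

text \<open>In exponential coordinates a homomorphism from \<open>\<int>\<^sup>k\<close> to \<open>G\<close> is a linear map
  \<open>v \<mapsto> (X v, Y v, z \<bullet> v)\<close> with \<open>z\<^sub>i x\<^sub>j = z\<^sub>j x\<^sub>i\<close>; so either \<open>z = 0\<close> or
  \<open>X\<close> is the product of a column and the row \<open>z\<close>.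
  The element with parameter \<open>n\<close> displaces a point at height \<open>s - (z \<bullet> n) / 2\<close> by
  \<open>((Y + s X) n, z \<bullet> n)\<close>. Hence, if for every \<open>s\<close> the linear map \<open>v \<mapsto> ((Y + s X) v, z \<bullet> v)\<close> is
  injective, compactness in \<open>s\<close> bounds the \<open>n\<close> that return to a compact set. If it kills some
  \<open>v \<noteq> 0\<close> for some \<open>s\<close>, rounding the multiples of \<open>v\<close> to integer vectors gives infinitely
  many elements with bounded displacement.
  Conjugation fixes \<open>X\<close> and \<open>z\<close> and adds to \<open>Y\<close> a matrix \<open>a z\<^sup>t - c X\<close>. If \<open>z \<noteq> 0\<close>,
  these are all matrices \<open>a' z\<^sup>t\<close> and the normal form is \<open>Y z = 0\<close>; if \<open>z = 0\<close>, the normal form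
  is the \<open>Y\<close> orthogonal to \<open>X\<close>.\<close>

section \<open>Linear data attached to a homomorphism\<close>

definition rvec :: "int ^ 'k \<Rightarrow> real ^ 'k" where
  "rvec n = (\<chi> i. real_of_int (n $ i))"

definition rho :: "real ^ 'k ^ 'k \<Rightarrow> real ^ 'k ^ 'k \<Rightarrow> real ^ 'k \<Rightarrow> int ^ 'k \<Rightarrow> ('k::finite) gmat" where
  "rho X Y z n = gexp (X *v rvec n) (Y *v rvec n) (z \<bullet> rvec n)"

definition outer :: "real ^ 'k \<Rightarrow> real ^ 'k \<Rightarrow> real ^ 'k ^ 'k" where
  "outer a z = (\<chi> i j. a $ i * z $ j)"

text \<open>The bracket of the Lie algebra elements with parameters
  \<open>(column i X, _, z $ i)\<close> and \<open>(column j X, _, z $ j)\<close> vanishes exactly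
  under this relation, so it says that the images of the generators commute.\<close>

definition commuting :: "real ^ 'k ^ 'k \<Rightarrow> real ^ 'k \<Rightarrow> bool" where
  "commuting X z \<longleftrightarrow> (\<forall>i j. z $ i *\<^sub>R column j X = z $ j *\<^sub>R column i X)"

definition nondegenerate :: "real ^ 'k ^ 'k \<Rightarrow> real ^ 'k ^ 'k \<Rightarrow> real ^ 'k::finite \<Rightarrow> bool" where
  "nondegenerate X Y z \<longleftrightarrow> (\<forall>s v. (Y + s *\<^sub>R X) *v v = 0 \<longrightarrow> z \<bullet> v = 0 \<longrightarrow> v = 0)"

lemma rvec_add: "rvec (m + n) = rvec m + rvec n"
  and rvec_diff: "rvec (m - n) = rvec m - rvec n"
  and rvec_0: "rvec 0 = 0"
  and rvec_axis: "rvec (axis j 1) = axis j 1"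
  and rvec_eq_0_iff: "rvec n = 0 \<longleftrightarrow> n = 0"
  by (auto simp: rvec_def vec_eq_iff axis_def)

lemma outer_mult_vector: "outer a z *v v = (z \<bullet> v) *\<^sub>R a"
  by (simp add: outer_def matrix_vector_mult_def vec_eq_iff inner_vec_def sum_distrib_left
      mult_ac)

lemma column_outer: "column j (outer a z) = z $ j *\<^sub>R a"
  by (simp add: outer_def column_def vec_eq_iff)

lemma commuting_outer: "commuting (outer x z) z"
  by (simp add: commuting_def column_outer mult.commute)

lemma commuting_0: "commuting X 0"
  by (simp add: commuting_def)

text \<open>At an index \<open>i\<close> with \<open>z $ i\<close> nonzero, every column j is
  \<open>z $ j / z $ i\<close> times column i.\<close>

lemma commuting_imp_outer:
  assumes "commuting X z" "z \<noteq> 0"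
  obtains x where "X = outer x z"
proof -
  obtain i where i: "z $ i \<noteq> 0" using assms(2) by (auto simp: vec_eq_iff)
  have "z $ i * X $ l $ j = z $ j * X $ l $ i" for l j
    using assms(1) by (simp add: commuting_def column_def vec_eq_iff)
  then have "X = outer ((1 / z $ i) *\<^sub>R column i X) z"
    using i by (simp add: outer_def column_def vec_eq_iff field_simps)
  then show ?thesis by (rule that)
qed

text \<open>This kills the bracket term of \<open>gexp_mult\<close> on the values of
  \<open>rho\<close>, which makes \<open>rho\<close> additive.\<close>

lemma commuting_swap:
  assumes "commuting X z"
  shows "(z \<bullet> v) *\<^sub>R (X *v w) = (z \<bullet> w) *\<^sub>R (X *v v)"
proof (cases "z = 0")
  case False
  then obtain x where "X = outer x z" using commuting_imp_outer assms by blast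
  then show ?thesis by (simp add: outer_mult_vector mult.commute)
qed simp

section \<open>The group in exponential coordinates\<close>

lemma gexp_in_carrier: "gexp x y z \<in> carrier GG"
  unfolding gexp_def carrier_GG_iff by blast

lemma gexp_inject: "gexp x y z = gexp x' y' z' \<longleftrightarrow> x = x' \<and> y = y' \<and> z = z'"
  by (auto simp: gexp_def block_inject)

text \<open>The Baker-Campbell-Hausdorff formula: the Lie algebra is two-step nilpotent, so the
  series stops after half the bracket.\<close>

lemma gexp_mult:
  "gexp x y z \<otimes>\<^bsub>GG\<^esub> gexp x' y' z' =
   gexp (x + x') (y + y' + (1 / 2) *\<^sub>R (z' *\<^sub>R x - z *\<^sub>R x')) (z + z')"
proof -
  have "y' + (z' / 2) *\<^sub>R x' + (z' *\<^sub>R x + (y + (z / 2) *\<^sub>R x)) =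
    y + y' + (1 / 2) *\<^sub>R (z' *\<^sub>R x - z *\<^sub>R x') + ((z + z') / 2) *\<^sub>R (x + x')"
    by (simp add: vec_eq_iff field_simps)
  then show ?thesis
    by (simp add: GG_def gexp_def block_mult block_inject add_ac)
qed

lemma carrier_GG_gexp:
  assumes "g \<in> carrier GG"
  obtains x y z where "g = gexp x y z"
proof -
  obtain x y z where "g = block x y z 1" using assms carrier_GG_iff by blast
  then have "g = gexp x (y - (z / 2) *\<^sub>R x) z" by (simp add: gexp_def)
  then show ?thesis by (rule that)
qed

lemma gexp_commute_imp:
  assumes "gexp x y z \<otimes>\<^bsub>GG\<^esub> gexp x' y' z' = gexp x' y' z' \<otimes>\<^bsub>GG\<^esub> gexp x y z"
  shows "z *\<^sub>R x' = z' *\<^sub>R x"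
proof -
  have "y + y' + (1 / 2) *\<^sub>R (z' *\<^sub>R x - z *\<^sub>R x') =
      y' + y + (1 / 2) *\<^sub>R (z *\<^sub>R x' - z' *\<^sub>R x)"
    using assms by (simp only: gexp_mult gexp_inject)
  then show ?thesis by (simp add: vec_eq_iff field_simps)
qed

lemma inv_block: "inv\<^bsub>GG\<^esub> (block a b c 1) = block (- a) (c *\<^sub>R a - b) (- c) (1::real)"
proof (rule group.inv_equality[OF group_GG])
  show "block (- a) (c *\<^sub>R a - b) (- c) 1 \<otimes>\<^bsub>GG\<^esub> block a b c 1 = \<one>\<^bsub>GG\<^esub>"
    by (simp add: GG_def block_mult mat_1_block)
qed (use carrier_GG_iff in blast)+

text \<open>By two-step nilpotency the adjoint action is the identity plus a bracket, and brackets
  lie in the y direction.\<close>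

lemma conjugate_gexp:
  "block a b c 1 \<otimes>\<^bsub>GG\<^esub> gexp x y z \<otimes>\<^bsub>GG\<^esub> inv\<^bsub>GG\<^esub> (block a b c 1) =
   gexp x (y + z *\<^sub>R a - c *\<^sub>R x) z"
  by (simp add: inv_block) (simp add: GG_def gexp_def block_mult block_inject algebra_simps)

text \<open>Written so that the displacement is read off at the height midway between
  \<open>s\<close> and \<open>s + z\<close>.\<close>

lemma act_gexp: "act (gexp x y z) (\<xi>, s) = (\<xi> + (y + (s + z / 2) *\<^sub>R x), s + z)"
  by (simp add: gexp_def act_block algebra_simps)

section \<open>Homomorphisms as linear data\<close>

lemma rho_in_hom:
  assumes "commuting X z"
  shows "rho X Y z \<in> hom Zk GG"
proof -
  have "rho X Y z (m + n) = rho X Y z m \<otimes>\<^bsub>GG\<^esub> rho X Y z n" for m n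
    unfolding rho_def gexp_mult gexp_inject commuting_swap[OF assms, of "rvec n" "rvec m"]
    by (simp add: rvec_add matrix_vector_right_distrib inner_add_right)
  then show ?thesis by (simp add: hom_def Zk_def rho_def gexp_in_carrier)
qed

lemma ev_rho: "ev (rho X Y z) = (\<chi> j. gexp (column j X) (column j Y) (z $ j))"
  by (simp add: ev_def rho_def rvec_axis matrix_vector_mult_basis inner_axis)

lemma ev_rho_inject: "ev (rho X Y z) = ev (rho X' Y' z') \<longleftrightarrow> X = X' \<and> Y = Y' \<and> z = z'"
proof
  assume "ev (rho X Y z) = ev (rho X' Y' z')"
  then have "gexp (column j X) (column j Y) (z $ j) = gexp (column j X') (column j Y') (z' $ j)"
    for j
    unfolding ev_rho vec_lambda_inject[OF UNIV_I UNIV_I] by (rule fun_cong)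
  then show "X = X' \<and> Y = Y' \<and> z = z'"
    unfolding gexp_inject by (simp add: column_def vec_eq_iff)
qed simp

lemma hom_of_ev: "\<phi> \<in> hom Zk GG \<Longrightarrow> hom_of (ev \<phi>) = \<phi>"
  unfolding hom_of_def by (rule inv_into_f_f[OF inj_on_ev])

text \<open>The generators commute, so their coordinates form commuting data; the resulting
  \<open>rho\<close> agrees with the homomorphism on generators, hence everywhere by
  \<open>inj_on_ev\<close>.\<close>

lemma hom_eq_rho:
  assumes "\<phi> \<in> hom Zk GG"
  obtains X Y z where "commuting X z" "\<phi> = rho X Y z"
proof -
  have "\<exists>x y z. \<phi> (axis j 1) = gexp x y z" for j
  proof -
    have "\<phi> (axis j 1) \<in> carrier GG" using assms by (auto simp: hom_def Zk_def)
    then show ?thesis by (metis carrier_GG_gexp)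
  qed
  then obtain x y z where xyz: "\<And>j. \<phi> (axis j 1) = gexp (x j) (y j) (z j)" by metis
  let ?X = "\<chi> i j. x j $ i" and ?Y = "\<chi> i j. y j $ i" and ?z = "\<chi> j. z j"
  have "\<phi> (axis i 1) \<otimes>\<^bsub>GG\<^esub> \<phi> (axis j 1) = \<phi> (axis j 1) \<otimes>\<^bsub>GG\<^esub> \<phi> (axis i 1)" for i j
    using assms by (simp add: hom_def Zk_def) (metis add.commute)
  then have "z i *\<^sub>R x j = z j *\<^sub>R x i" for i j
    unfolding xyz by (rule gexp_commute_imp)
  then have comm: "commuting ?X ?z"
    by (simp add: commuting_def column_def vec_eq_iff)
  have "ev \<phi> = ev (rho ?X ?Y ?z)"
    unfolding ev_rho by (simp add: ev_def xyz column_def)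
  then have "\<phi> = rho ?X ?Y ?z"
    using inj_on_ev assms rho_in_hom[OF comm] by (metis inj_onD)
  with comm show ?thesis by (rule that)
qed

lemma conjugate_rho:
  "conjugate (block a b c 1) (rho X Y z) = rho X (Y + outer a z - c *\<^sub>R X) z"
  unfolding conjugate_def rho_def conjugate_gexp fun_eq_iff gexp_inject
  by (simp add: outer_mult_vector matrix_vector_mult_add_rdistrib
      matrix_vector_mult_diff_rdistrib scaleR_matrix_vector_assoc)

section \<open>Nondegenerate data act properly discontinuously and freely\<close>

lemma finite_rvec_bounded: "finite {n :: int ^ 'k::finite. norm (rvec n) \<le> B}"
proof -
  let ?I = "{- \<lceil>B\<rceil>..\<lceil>B\<rceil>}"
  have "finite {f :: 'k \<Rightarrow> int. \<forall>i. f i \<in> ?I}"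
    using finite_PiE[of "UNIV :: 'k set" "\<lambda>_. ?I"] by (simp add: PiE_def Pi_def)
  then have "finite (vec_lambda ` {f :: 'k \<Rightarrow> int. \<forall>i. f i \<in> ?I})" by (rule finite_imageI)
  moreover have "{n :: int ^ 'k. norm (rvec n) \<le> B} \<subseteq> vec_lambda ` {f. \<forall>i. f i \<in> ?I}"
  proof
    fix n :: "int ^ 'k" assume "n \<in> {n. norm (rvec n) \<le> B}"
    then have "\<bar>rvec n $ i\<bar> \<le> B" for i
      using component_le_norm_cart[of "rvec n" i] by simp
    then have "\<bar>real_of_int (n $ i)\<bar> \<le> B" for i by (simp add: rvec_def)
    then have "n $ i \<in> ?I" for i
      by (smt (verit) atLeastAtMost_iff le_of_int_ceiling of_int_le_iff of_int_minus)
    then show "n \<in> vec_lambda ` {f. \<forall>i. f i \<in> ?I}"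
      by (intro image_eqI[of _ _ "vec_nth n"]) auto
  qed
  ultimately show ?thesis by (rule finite_subset[rotated])
qed

text \<open>Both sides are homogeneous in \<open>v\<close>, so unit vectors suffice; there a
  positive continuous function on a compact set attains its minimum, which serves as
  \<open>c\<close>.\<close>

lemma nondegenerate_bound:
  fixes X Y :: "real ^ 'k ^ 'k::finite"
  assumes "nondegenerate X Y z"
  obtains c where "c > 0"
    "\<And>s v. \<bar>s\<bar> \<le> R \<Longrightarrow> c * norm v \<le> norm ((Y + s *\<^sub>R X) *v v) + \<bar>z \<bullet> v\<bar>"
proof (cases "R \<ge> 0")
  case True
  let ?K = "{-R..R} \<times> sphere (0 :: real ^ 'k) 1"
  let ?f = "\<lambda>(s, v). norm (Y *v v + s *\<^sub>R (X *v v)) + \<bar>z \<bullet> v\<bar>"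
  have eq: "(Y + s *\<^sub>R X) *v v = Y *v v + s *\<^sub>R (X *v v)" for s v
    by (simp add: matrix_vector_mult_add_rdistrib scaleR_matrix_vector_assoc)
  have cont: "continuous_on ?K (\<lambda>p. A *v snd p)" for A :: "real ^ 'k ^ 'k"
    by (rule linear_continuous_on_compose[OF _ matrix_vector_mul_linear])
      (intro continuous_intros)
  have "compact ?K" by (intro compact_Times) auto
  moreover have "?K \<noteq> {}" using True by (auto intro: exI[of _ 0])
  moreover have "continuous_on ?K ?f"
    unfolding case_prod_unfold
    by (intro continuous_intros cont)
  ultimately have "\<exists>p\<in>?K. \<forall>q\<in>?K. ?f p \<le> ?f q" by (rule continuous_attains_inf)
  then obtain p where p: "p \<in> ?K" "\<And>q. q \<in> ?K \<Longrightarrow> ?f p \<le> ?f q"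
    by (elim bexE) (rule that, assumption, rule bspec)
  obtain s0 v0 where sv: "p = (s0, v0)" by (cases p)
  have "v0 \<noteq> 0" using p(1) sv by auto
  then have "Y *v v0 + s0 *\<^sub>R (X *v v0) \<noteq> 0 \<or> z \<bullet> v0 \<noteq> 0"
    using assms unfolding nondegenerate_def eq by blast
  then have pos: "?f p > 0"
    unfolding sv by (auto intro: add_pos_nonneg add_nonneg_pos)
  have "?f p * norm v \<le> norm ((Y + s *\<^sub>R X) *v v) + \<bar>z \<bullet> v\<bar>" if "\<bar>s\<bar> \<le> R" for s v
  proof (cases "v = 0")
    case False
    let ?u = "(1 / norm v) *\<^sub>R v"
    have "(s, ?u) \<in> ?K" using that False by auto
    then have "?f p \<le> ?f (s, ?u)" by (rule p(2))
    also have "\<dots> = norm ((1 / norm v) *\<^sub>R (Y *v v + s *\<^sub>R (X *v v))) + \<bar>z \<bullet> v\<bar> / norm v"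
      by (simp add: matrix_vector_mult_scaleR scaleR_right_distrib divide_inverse abs_mult
          mult.commute)
    also have "\<dots> = (norm (Y *v v + s *\<^sub>R (X *v v)) + \<bar>z \<bullet> v\<bar>) / norm v"
      by (simp add: add_divide_distrib)
    finally show ?thesis using False by (simp add: eq field_simps)
  qed simp
  with pos show ?thesis by (rule that)
next
  case False
  \<comment> \<open>For negative \<open>R\<close> no \<open>s\<close> qualifies, so any positive
    constant will do.\<close>
  then show ?thesis by (intro that[of 1]) auto
qed

lemma properly_discontinuous_rho:
  fixes X Y :: "real ^ 'k ^ 'k::finite"
  assumes "nondegenerate X Y z"
  shows "properly_discontinuous (range (rho X Y z))"
  unfolding properly_discontinuous_def
proof (intro allI impI)
  fix S :: "((real ^ 'k) \<times> real) set" assume "compact S"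
  then obtain R where R: "\<And>p. p \<in> S \<Longrightarrow> norm p \<le> R"
    using compact_imp_bounded bounded_iff by metis
  \<comment> \<open>When a point of \<open>S\<close> returns to \<open>S\<close>, both heights are
    at most \<open>R\<close> in absolute value, so the midpoint height stays within
    \<open>2 * R\<close>.\<close>
  obtain c where c: "c > 0"
    "\<And>s v. \<bar>s\<bar> \<le> 2 * R \<Longrightarrow> c * norm v \<le> norm ((Y + s *\<^sub>R X) *v v) + \<bar>z \<bullet> v\<bar>"
    using nondegenerate_bound[OF assms] by blast
  have "{\<gamma> \<in> range (rho X Y z). act \<gamma> ` S \<inter> S \<noteq> {}}
      \<subseteq> rho X Y z ` {n. norm (rvec n) \<le> 4 * R / c}"
  proof
    fix \<gamma> assume "\<gamma> \<in> {\<gamma> \<in> range (rho X Y z). act \<gamma> ` S \<inter> S \<noteq> {}}"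
    then obtain n \<xi> s where \<gamma>: "\<gamma> = rho X Y z n" and
      S: "(\<xi>, s) \<in> S" "act (rho X Y z n) (\<xi>, s) \<in> S"
      by force
    let ?v = "rvec n" let ?s = "s + (z \<bullet> ?v) / 2"
    let ?d = "(Y + ?s *\<^sub>R X) *v ?v"
    have "act (rho X Y z n) (\<xi>, s) = (\<xi> + ?d, s + z \<bullet> ?v)"
      by (simp add: rho_def act_gexp matrix_vector_mult_add_rdistrib scaleR_matrix_vector_assoc)
    then have "norm (\<xi>, s) \<le> R" "norm (\<xi> + ?d, s + z \<bullet> ?v) \<le> R"
      using R S by metis+
    then have b: "norm \<xi> \<le> R" "\<bar>s\<bar> \<le> R" "norm (\<xi> + ?d) \<le> R" "\<bar>s + z \<bullet> ?v\<bar> \<le> R"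
      using norm_fst_le[of \<xi> s] norm_snd_le[of s \<xi>]
        norm_fst_le[of "\<xi> + ?d" "s + z \<bullet> ?v"] norm_snd_le[of "s + z \<bullet> ?v" "\<xi> + ?d"]
      by (auto simp del: norm_Pair)
    \<comment> \<open>Two points of \<open>S\<close> differ by at most \<open>2 * R\<close> in each
      component; the two displacements together give the bound \<open>4 * R\<close>.\<close>
    have "norm ?d \<le> 2 * R" using b norm_triangle_sub[of ?d "- \<xi>"] by (simp add: add.commute)
    moreover have "\<bar>z \<bullet> ?v\<bar> \<le> 2 * R" "\<bar>?s\<bar> \<le> 2 * R" using b by linarith+
    ultimately have "c * norm ?v \<le> 4 * R" using c(2)[of ?s ?v] by linarith
    then show "\<gamma> \<in> rho X Y z ` {n. norm (rvec n) \<le> 4 * R / c}"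
      using c(1) by (auto simp: \<gamma> field_simps)
  qed
  then show "finite {\<gamma> \<in> range (rho X Y z). act \<gamma> ` S \<inter> S \<noteq> {}}"
    by (rule finite_subset) (intro finite_imageI finite_rvec_bounded)
qed

lemma rho_in_RR:
  assumes "commuting X z" "nondegenerate X Y z"
  shows "rho X Y z \<in> RR"
proof -
  have nd: "n = 0" if "(Y + s *\<^sub>R X) *v rvec n = 0" "z \<bullet> rvec n = 0" for s n
    using assms(2) that unfolding nondegenerate_def by (metis rvec_eq_0_iff)
  have "inj (rho X Y z)"
  proof (rule injI)
    fix m n assume "rho X Y z m = rho X Y z n"
    then have "Y *v rvec (m - n) = 0" "z \<bullet> rvec (m - n) = 0"
      by (simp_all add: rho_def gexp_inject rvec_diff matrix_vector_mult_diff_distrib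
          inner_diff_right)
    then have "m - n = 0" using nd[of 0 "m - n"] by simp
    then show "m = n" by simp
  qed
  moreover have "acts_freely (range (rho X Y z))"
    unfolding acts_freely_def
  proof clarify
    fix n \<xi> s assume "act (rho X Y z n) (\<xi>, s) = (\<xi>, s)"
    \<comment> \<open>A fixed point forces \<open>z \<bullet> rvec n = 0\<close>, so the midpoint
      height is \<open>s\<close> itself.\<close>
    then have "n = 0"
      by (intro nd[of s])
        (auto simp: rho_def act_gexp matrix_vector_mult_add_rdistrib scaleR_matrix_vector_assoc)
    then show "rho X Y z n = mat 1"
      by (simp add: rho_def rvec_0 gexp_def mat_1_block)
  qed
  ultimately show ?thesis
    using rho_in_hom[OF assms(1)] properly_discontinuous_rho[OF assms(2)] by (simp add: RR_def)
qed

section \<open>Proper discontinuity forces nondegeneracy\<close>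

text \<open>Rounding \<open>t *\<^sub>R v\<close> coordinatewise errs by at most 1 in each entry,
  hence by at most k in norm, while \<open>t\<close> is arbitrary.\<close>

lemma infinite_rvec_near_line:
  fixes v :: "real ^ 'k::finite"
  assumes "v \<noteq> 0"
  shows "infinite {n. \<exists>t r. rvec n = t *\<^sub>R v + r \<and> norm r \<le> real CARD('k)}"
proof
  let ?N = "{n. \<exists>t r. rvec n = t *\<^sub>R v + r \<and> norm r \<le> real CARD('k)}"
  assume "finite ?N"
  then have "finite ((\<lambda>n. norm (rvec n)) ` ?N)" by simp
  then obtain B where B: "\<And>n. n \<in> ?N \<Longrightarrow> norm (rvec n) \<le> B"
    by (meson bdd_above_finite bdd_above.E imageI)
  \<comment> \<open>This makes \<open>t *\<^sub>R v\<close> longer than \<open>B\<close> plus the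
    rounding error, so the rounded vector violates the bound \<open>B\<close>.\<close>
  define t where "t = (B + real CARD('k) + 1) / norm v"
  define n :: "int ^ 'k" where "n = (\<chi> i. \<lfloor>t * v $ i\<rfloor>)"
  let ?r = "rvec n - t *\<^sub>R v"
  have "\<bar>?r $ i\<bar> \<le> 1" for i
    by (simp add: rvec_def n_def) linarith
  then have "norm ?r \<le> (\<Sum>i\<in>(UNIV :: 'k set). 1)"
    by (intro order_trans[OF norm_le_l1_cart] sum_mono)
  then have r: "norm ?r \<le> real CARD('k)" by simp
  then have "n \<in> ?N" by (auto intro!: exI[of _ t] exI[of _ ?r])
  then have "norm (rvec n) \<le> B" by (rule B)
  moreover have "norm (t *\<^sub>R v) = \<bar>B + real CARD('k) + 1\<bar>"
    using assms by (simp add: t_def)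
  ultimately show False
    using r norm_triangle_ineq4[of "rvec n" ?r] by simp
qed

lemma RR_imp_nondegenerate:
  fixes X Y :: "real ^ 'k ^ 'k::finite"
  assumes "rho X Y z \<in> RR"
  shows "nondegenerate X Y z"
  unfolding nondegenerate_def
proof (intro allI impI, rule ccontr)
  fix s v assume v: "(Y + s *\<^sub>R X) *v v = 0" "z \<bullet> v = 0" "v \<noteq> 0"
  let ?A = "Y + s *\<^sub>R X"
  let ?N = "{n. \<exists>t r. rvec n = t *\<^sub>R v + r \<and> norm r \<le> real CARD('k)}"
  let ?B = "cball (0 :: real ^ 'k) (real CARD('k))"
  \<comment> \<open>Starting at height \<open>s - (z \<bullet> r) / 2\<close> puts the midpoint at
    height \<open>s\<close>, where \<open>?A\<close> kills the component along \<open>v\<close>.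
    Only the bounded remainder \<open>r\<close> contributes to the displacement, so all starting
    points and all images fill one compact set.\<close>
  define S where
    "S = (\<lambda>r. (0, s - (z \<bullet> r) / 2)) ` ?B \<union> (\<lambda>r. (?A *v r, s + (z \<bullet> r) / 2)) ` ?B"
  have "compact S"
    unfolding S_def
    by (intro compact_Un compact_continuous_image continuous_intros
        linear_continuous_on[OF linear_conv_bounded_linear[THEN iffD1]]
        matrix_vector_mul_linear compact_cball) auto
  then have "finite {\<gamma> \<in> range (rho X Y z). act \<gamma> ` S \<inter> S \<noteq> {}}"
    using assms unfolding RR_def properly_discontinuous_def by blast
  moreover have "rho X Y z ` ?N \<subseteq> {\<gamma> \<in> range (rho X Y z). act \<gamma> ` S \<inter> S \<noteq> {}}"
  proof clarify
    fix n t r assume n: "rvec n = t *\<^sub>R v + r" and r: "norm r \<le> real CARD('k)"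
    have "?A *v rvec n = ?A *v r"
      using v(1) by (simp add: n matrix_vector_right_distrib matrix_vector_mult_scaleR)
    moreover have "z \<bullet> rvec n = z \<bullet> r"
      using v(2) by (simp add: n inner_add_right)
    ultimately have "act (rho X Y z n) (0, s - (z \<bullet> r) / 2) = (?A *v r, s + (z \<bullet> r) / 2)"
      by (simp add: rho_def act_gexp matrix_vector_mult_add_rdistrib scaleR_matrix_vector_assoc)
    moreover have "(0, s - (z \<bullet> r) / 2) \<in> S" "(?A *v r, s + (z \<bullet> r) / 2) \<in> S"
      using r by (auto simp: S_def)
    ultimately have "act (rho X Y z n) ` S \<inter> S \<noteq> {}"
      by (metis IntI empty_iff image_eqI)
    then show "rho X Y z n \<in> range (rho X Y z) \<and> act (rho X Y z n) ` S \<inter> S \<noteq> {}"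
      by blast
  qed
  ultimately have "finite (rho X Y z ` ?N)" by (rule finite_subset[rotated])
  \<comment> \<open>Injectivity turns the infinitely many integer vectors into infinitely many group
    elements.\<close>
  moreover have "inj_on (rho X Y z) ?N"
    using assms by (auto simp: RR_def intro: inj_on_subset)
  ultimately show False
    using infinite_rvec_near_line[OF v(3)] finite_imageD[of "rho X Y z" ?N] by argo
qed

section \<open>The parameter sets in terms of nondegeneracy\<close>

lemma Psi1_eq_ev_rho: "Psi1 (x, Y, z) = ev (rho (outer x z) Y z)"
  by (simp add: Psi1_def ev_rho column_outer)

lemma Psi2_eq_ev_rho: "Psi2 (X, Y) = ev (rho X Y 0)"
  by (simp add: Psi2_def ev_rho)

lemma transpose_append_column_eq_0_iff:
  "transpose (append_column (transpose Y) z) *v v = 0 \<longleftrightarrow> Y *v v = 0 \<and> z \<bullet> v = 0"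
  by (auto simp: vec_eq_iff matrix_vector_mult_def transpose_def append_column_def
      split_sum_all inner_vec_def)

text \<open>The matrix \<open>outer x z\<close> vanishes on the orthogonal complement of
  \<open>z\<close>, so the condition is the same for all \<open>s\<close>.\<close>

lemma nondegenerate_outer_iff:
  "nondegenerate (outer x z) Y z \<longleftrightarrow> (\<forall>v. Y *v v = 0 \<and> z \<bullet> v = 0 \<longrightarrow> v = 0)"
proof -
  have "(Y + s *\<^sub>R outer x z) *v v = Y *v v" if "z \<bullet> v = 0" for s v
    using that by (simp add: matrix_vector_mult_add_rdistrib
        scaleR_matrix_vector_assoc[symmetric] outer_mult_vector)
  then show ?thesis unfolding nondegenerate_def by metis
qed

text \<open>The null space is the orthogonal complement of the row space.\<close>

lemma dim_nullspace:
  fixes A :: "real ^ 'n ^ 'm"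
  shows "dim {v. A *v v = 0} + rank A = CARD('n)"
proof -
  have "A *v v = 0 \<longleftrightarrow> (\<forall>u\<in>span (rows A). orthogonal u v)" for v
  proof
    assume "\<forall>u\<in>span (rows A). orthogonal u v"
    then have "orthogonal (row i A) v" for i by (auto simp: rows_def intro: span_base)
    then show "A *v v = 0"
      by (simp add: orthogonal_def vec_eq_iff matrix_vector_mul_component row_def)
  qed (use orthogonal_nullspace_rowspace orthogonal_commute in blast)
  then show ?thesis
    using dim_subspace_orthogonal_to_vectors[of "span (rows A)" UNIV]
    by (simp add: row_rank_def)
qed

text \<open>Full row rank means that the transpose is injective, and the kernel of the transpose is
  the part of the kernel of \<open>Y\<close> orthogonal to \<open>z\<close>.\<close>

lemma M1r_iff: "(x, Y, z) \<in> M1r \<longleftrightarrow> z \<noteq> 0 \<and> nondegenerate (outer x z) Y z"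
proof -
  let ?A = "transpose (append_column (transpose Y) z)"
  have "rank (append_column (transpose Y) z) = CARD('a) \<longleftrightarrow> rank ?A = CARD('a)"
    by (simp add: rank_transpose)
  also have "\<dots> \<longleftrightarrow> inj ((*v) ?A)" by (rule full_rank_injective)
  also have "\<dots> \<longleftrightarrow> (\<forall>v. Y *v v = 0 \<and> z \<bullet> v = 0 \<longrightarrow> v = 0)"
    unfolding linear_injective_0[OF matrix_vector_mul_linear]
      transpose_append_column_eq_0_iff ..
  also have "\<dots> \<longleftrightarrow> nondegenerate (outer x z) Y z"
    by (simp add: nondegenerate_outer_iff)
  finally show ?thesis by (simp add: M1r_def)
qed

text \<open>The two parameters correspond by \<open>s = - l\<close>.\<close>

lemma M2r_iff: "(X, Y) \<in> M2r \<longleftrightarrow> nondegenerate X Y 0"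
proof -
  have "det (Y - l *\<^sub>R X) \<noteq> 0 \<longleftrightarrow> (\<forall>v. (Y + (- l) *\<^sub>R X) *v v = 0 \<longrightarrow> v = 0)" for l
    by (simp add: invertible_det_nz[symmetric] invertible_left_inverse
        matrix_left_invertible_ker)
  then show ?thesis
    unfolding M2r_def nondegenerate_def by simp (metis minus_minus scaleR_minus_left diff_minus_eq_add)
qed

text \<open>Once \<open>Y\<close> kills \<open>z\<close>, rank k - 1 means that its kernel is the
  line through \<open>z\<close>, equivalently that the kernel meets the complement of
  \<open>z\<close> only in 0.\<close>

lemma D1_iff: "(x, Y, z) \<in> D1 \<longleftrightarrow> (x, Y, z) \<in> M1r \<and> Y *v z = 0"
proof -
  have orth: "(\<forall>j. orthogonal (row j Y) z) \<longleftrightarrow> Y *v z = 0"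
    by (simp add: orthogonal_def vec_eq_iff matrix_vector_mul_component row_def)
  have "rank (transpose Y) = CARD('a) - 1 \<longleftrightarrow> nondegenerate (outer x z) Y z"
    if z: "z \<noteq> 0" and Yz: "Y *v z = 0"
  proof -
    let ?K = "{v. Y *v v = 0}"
    have sub: "subspace ?K" by (rule linear_subspace_kernel[OF matrix_vector_mul_linear])
    have span: "span {z} \<subseteq> ?K" using Yz sub by (intro span_minimal) auto
    have dim: "dim (span {z}) = 1" using z by (simp add: dim_insert)
    \<comment> \<open>As k is positive, the natural number subtraction k - 1 is exact.\<close>
    have "rank (transpose Y) = CARD('a) - 1 \<longleftrightarrow> dim ?K = 1"
      using dim_nullspace[of Y] zero_less_card_finite[where 'a='a] rank_bound[of Y]
      unfolding rank_transpose by linarith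
    also have "\<dots> \<longleftrightarrow> ?K = span {z}"
      using dim subspace_dim_equal[OF subspace_span sub span] by auto
    also have "\<dots> \<longleftrightarrow> nondegenerate (outer x z) Y z"
    proof
      assume K: "?K = span {z}"
      have "v = 0" if "Y *v v = 0" "z \<bullet> v = 0" for v
      proof -
        have "v \<in> span {z}" using K that(1) by blast
        then obtain c where "v = c *\<^sub>R z" by (auto simp: span_singleton)
        then show ?thesis using that(2) z by simp
      qed
      then show "nondegenerate (outer x z) Y z"
        by (simp add: nondegenerate_outer_iff)
    next
      assume nd: "nondegenerate (outer x z) Y z"
      have "v \<in> span {z}" if "Y *v v = 0" for v
      proof -
        \<comment> \<open>The projection of \<open>v\<close> to the complement of \<open>z\<close>;
          it stays in the kernel because \<open>Y\<close> kills \<open>z\<close>.\<close>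
        let ?w = "v - ((z \<bullet> v) / (z \<bullet> z)) *\<^sub>R z"
        have "Y *v ?w = 0" "z \<bullet> ?w = 0"
          using that Yz z
          by (simp_all add: matrix_vector_mult_diff_distrib matrix_vector_mult_scaleR
              inner_diff_right)
        then have "?w = 0" using nd unfolding nondegenerate_outer_iff by blast
        then have "v = ((z \<bullet> v) / (z \<bullet> z)) *\<^sub>R z" by simp
        then show ?thesis by (metis span_base span_scale singletonI)
      qed
      then show "?K = span {z}" using span by blast
    qed
    finally show ?thesis .
  qed
  then show ?thesis unfolding M1r_iff orth[symmetric] by (auto simp: D1_def orth)
qed

text \<open>The trace is the Frobenius inner product, which is the inner product of matrices as
  vectors of vectors.\<close>

lemma D2_iff: "(X, Y) \<in> D2 \<longleftrightarrow> (X, Y) \<in> M2r \<and> X \<bullet> Y = 0"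
  by (auto simp: D2_def M2r_def trace_def matrix_matrix_mult_def transpose_def inner_vec_def)

section \<open>Conjugacy classes in linear data\<close>

lemma equiv_conj_rel: "equiv RR (conj_rel :: ((int ^ 'k \<Rightarrow> ('k::finite) gmat) \<times> _) set)"
proof -
  interpret G: group "GG :: 'k gmat monoid" by (rule group_GG)
  have car: "\<phi> n \<in> carrier GG" if "\<phi> \<in> RR" for \<phi> :: "int ^ 'k \<Rightarrow> 'k gmat" and n
    using that by (auto simp: RR_def hom_def Zk_def)
  have one: "conjugate \<one>\<^bsub>GG\<^esub> \<phi> = \<phi>" if "\<phi> \<in> RR" for \<phi> :: "int ^ 'k \<Rightarrow> 'k gmat"
    using car[OF that] by (simp add: conjugate_def)
  have mult: "conjugate g (conjugate h \<phi>) = conjugate (g \<otimes>\<^bsub>GG\<^esub> h) \<phi>"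
    if "\<phi> \<in> RR" "g \<in> carrier GG" "h \<in> carrier GG" for g h and \<phi> :: "int ^ 'k \<Rightarrow> 'k gmat"
    using car[OF that(1)] that by (simp add: conjugate_def G.inv_mult_group G.m_assoc)
  show ?thesis
  proof (rule equivI)
    show "conj_rel \<subseteq> RR \<times> (RR :: (int ^ 'k \<Rightarrow> 'k gmat) set)" by (auto simp: conj_rel_def)
    show "refl_on RR (conj_rel :: ((int ^ 'k \<Rightarrow> 'k gmat) \<times> _) set)"
      by (auto simp: refl_on_def conj_rel_def one intro!: bexI[of _ "\<one>\<^bsub>GG\<^esub>"])
    show "sym (conj_rel :: ((int ^ 'k \<Rightarrow> 'k gmat) \<times> _) set)"
    proof (rule symI)
      fix \<phi> \<psi> :: "int ^ 'k \<Rightarrow> 'k gmat" assume "(\<phi>, \<psi>) \<in> conj_rel"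
      then obtain h where h: "\<phi> \<in> RR" "\<psi> \<in> RR" "h \<in> carrier GG" "\<psi> = conjugate h \<phi>"
        by (auto simp: conj_rel_def)
      then have "\<phi> = conjugate (inv\<^bsub>GG\<^esub> h) \<psi>" by (simp add: mult one)
      with h show "(\<psi>, \<phi>) \<in> conj_rel"
        unfolding conj_rel_def using G.inv_closed by blast
    qed
    show "trans (conj_rel :: ((int ^ 'k \<Rightarrow> 'k gmat) \<times> _) set)"
    proof (rule transI)
      fix \<phi> \<psi> \<theta> :: "int ^ 'k \<Rightarrow> 'k gmat"
      assume "(\<phi>, \<psi>) \<in> conj_rel" "(\<psi>, \<theta>) \<in> conj_rel"
      then obtain g h where "\<phi> \<in> RR" "\<theta> \<in> RR" "g \<in> carrier GG" "h \<in> carrier GG"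
        "\<theta> = conjugate g (conjugate h \<phi>)"
        by (auto simp: conj_rel_def)
      moreover from this have "\<theta> = conjugate (g \<otimes>\<^bsub>GG\<^esub> h) \<phi>" by (simp add: mult)
      ultimately show "(\<phi>, \<theta>) \<in> conj_rel"
        unfolding conj_rel_def using G.m_closed by blast
    qed
  qed
qed

lemma conj_rel_rho_iff:
  "(rho X Y z, rho X' Y' z') \<in> conj_rel \<longleftrightarrow>
    rho X Y z \<in> RR \<and> rho X' Y' z' \<in> RR \<and>
    X' = X \<and> z' = z \<and> (\<exists>a c. Y' = Y + outer a z - c *\<^sub>R X)"
proof -
  have "rho X' Y' z' = rho X Y'' z'' \<longleftrightarrow> X' = X \<and> Y' = Y'' \<and> z' = z''" for Y'' z''
    by (metis ev_rho_inject)
  moreover have "(\<exists>h\<in>carrier GG. P h) \<longleftrightarrow> (\<exists>a b c. P (block a b c 1))" for P :: "'a gmat \<Rightarrow> bool"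
    by (auto simp: GG_def)
  ultimately show ?thesis by (auto simp: conj_rel_def conjugate_rho)
qed

text \<open>Thus \<open>X\<close> and \<open>z\<close> are invariants of a class, and
  \<open>Y\<close> is determined modulo a linear space; the normal forms pick one representative of
  it.\<close>

lemma qmap_rho_eq_iff:
  assumes "rho X Y z \<in> RR" "rho X' Y' z' \<in> RR"
  shows "qmap (rho X Y z) = qmap (rho X' Y' z') \<longleftrightarrow>
    X' = X \<and> z' = z \<and> (\<exists>a c. Y' = Y + outer a z - c *\<^sub>R X)"
  unfolding qmap_def eq_equiv_class_iff[OF equiv_conj_rel assms] conj_rel_rho_iff
  using assms by simp

lemma rho_outer_in_RR: "(x, Y, z) \<in> M1r \<Longrightarrow> rho (outer x z) Y z \<in> RR"
  by (simp add: M1r_iff rho_in_RR commuting_outer)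

lemma rho_0_in_RR: "(X, Y) \<in> M2r \<Longrightarrow> rho X Y 0 \<in> RR"
  by (simp add: M2r_iff rho_in_RR commuting_0)

lemma RR_subset_hom: "RR \<subseteq> hom Zk GG"
  by (auto simp: RR_def)

lemma Psi1_bar_eq: "(x, Y, z) \<in> M1r \<Longrightarrow> Psi1_bar (x, Y, z) = qmap (rho (outer x z) Y z)"
  unfolding Psi1_bar_def Psi1_eq_ev_rho
  by (simp add: hom_of_ev subsetD[OF RR_subset_hom rho_outer_in_RR])

lemma Psi2_bar_eq: "(X, Y) \<in> M2r \<Longrightarrow> Psi2_bar (X, Y) = qmap (rho X Y 0)"
  unfolding Psi2_bar_def Psi2_eq_ev_rho
  by (simp add: hom_of_ev subsetD[OF RR_subset_hom rho_0_in_RR])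

lemma outer_inject: "z \<noteq> 0 \<Longrightarrow> outer x z = outer x' z \<longleftrightarrow> x = x'"
  by (auto simp: outer_def vec_eq_iff)

section \<open>Injectivity and surjectivity\<close>

lemma inj_on_Psi1_bar: "inj_on Psi1_bar D1"
proof (rule inj_onI)
  fix p q :: "(real ^ 'a) \<times> (real ^ 'a ^ 'a) \<times> (real ^ 'a)"
  assume pqD: "p \<in> D1" "q \<in> D1" and pq_eq: "Psi1_bar p = Psi1_bar q"
  obtain x Y z x' Y' z' where pq: "p = (x, Y, z)" "q = (x', Y', z')" by (cases p, cases q)
  note D = pqD[unfolded pq] and eq = pq_eq[unfolded pq]
  have M: "(x, Y, z) \<in> M1r" "(x', Y', z') \<in> M1r" and Yz: "Y *v z = 0" "Y' *v z' = 0"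
    using D by (auto simp: D1_iff)
  have z: "z \<noteq> 0" using M by (simp add: M1r_iff)
  obtain a c where *: "outer x' z' = outer x z" "z' = z" "Y' = Y + outer a z - c *\<^sub>R outer x z"
    using eq M by (auto simp: Psi1_bar_eq qmap_rho_eq_iff rho_outer_in_RR)
  have "x' = x" using * outer_inject[OF z] by simp
  \<comment> \<open>Here \<open>Y' - Y\<close> is \<open>outer (a - c *\<^sub>R x) z\<close>;
    applying it to \<open>z\<close> isolates the column factor.\<close>
  have "(z \<bullet> z) *\<^sub>R (a - c *\<^sub>R x) = Y' *v z - Y *v z"
    by (simp add: * scaleR_matrix_vector_assoc[symmetric] outer_mult_vector algebra_simps)
  then have "a = c *\<^sub>R x" using Yz z * by simp
  then have "Y' = Y" by (simp add: * outer_def vec_eq_iff)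
  then show "p = q" using \<open>x' = x\<close> * by (simp add: pq)
qed

lemma inj_on_Psi2_bar: "inj_on Psi2_bar D2"
proof (rule inj_onI)
  fix p q :: "(real ^ 'a ^ 'a) \<times> (real ^ 'a ^ 'a)"
  assume pqD: "p \<in> D2" "q \<in> D2" and pq_eq: "Psi2_bar p = Psi2_bar q"
  obtain X Y X' Y' where pq: "p = (X, Y)" "q = (X', Y')" by (cases p, cases q)
  note D = pqD[unfolded pq] and eq = pq_eq[unfolded pq]
  have M: "(X, Y) \<in> M2r" "(X', Y') \<in> M2r" and tr: "X \<bullet> Y = 0" "X' \<bullet> Y' = 0"
    using D by (auto simp: D2_iff)
  have "outer a 0 = (0 :: real ^ 'a ^ 'a)" for a by (simp add: outer_def vec_eq_iff)
  then obtain c where *: "X' = X" "Y' = Y - c *\<^sub>R X"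
    using eq M by (auto simp: Psi2_bar_eq qmap_rho_eq_iff rho_0_in_RR)
  \<comment> \<open>Pairing with \<open>X\<close> leaves \<open>c = 0\<close> or
    \<open>X = 0\<close>; either way \<open>Y' = Y\<close>.\<close>
  then have "c * (X \<bullet> X) = 0" using tr by (simp add: inner_diff_right)
  then show "p = q" using * by (auto simp: pq)
qed

text \<open>The invariant \<open>z\<close> is nonzero on the first piece and zero on the
  second.\<close>

lemma Psi1_bar_neq_Psi2_bar:
  assumes "p \<in> D1" "q \<in> D2"
  shows "Psi1_bar p \<noteq> Psi2_bar q"
proof -
  obtain x Y z X' Y' where pq: "p = (x, Y, z)" "q = (X', Y')" by (cases p, cases q)
  have "(x, Y, z) \<in> M1r" "(X', Y') \<in> M2r" using assms by (auto simp: pq D1_iff D2_iff)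
  moreover from this have "z \<noteq> 0" by (simp add: M1r_iff)
  ultimately show ?thesis
    by (simp add: pq Psi1_bar_eq Psi2_bar_eq qmap_rho_eq_iff rho_outer_in_RR rho_0_in_RR)
qed

lemma qmap_in_image:
  assumes "\<phi> \<in> RR"
  shows "qmap \<phi> \<in> Psi1_bar ` D1 \<union> Psi2_bar ` D2"
proof -
  obtain X Y z where comm: "commuting X z" and \<phi>: "\<phi> = rho X Y z"
    using assms RR_subset_hom hom_eq_rho by blast
  have nd: "nondegenerate X Y z" using RR_imp_nondegenerate assms \<phi> by blast
  show ?thesis
  proof (cases "z = 0")
    case False
    then obtain x where X: "X = outer x z" using commuting_imp_outer comm by blast
    \<comment> \<open>Chosen so that \<open>outer a z *v z\<close> cancels
      \<open>Y *v z\<close>.\<close>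
    define a where "a = - (1 / (z \<bullet> z)) *\<^sub>R (Y *v z)"
    define Y' where "Y' = Y + outer a z"
    have "Y' *v z = 0"
      using False by (simp add: Y'_def a_def matrix_vector_mult_add_rdistrib outer_mult_vector)
    moreover have "nondegenerate (outer x z) Y' z"
      using nd unfolding X nondegenerate_outer_iff
      by (auto simp: Y'_def matrix_vector_mult_add_rdistrib outer_mult_vector)
    then have M: "(x, Y', z) \<in> M1r" using False by (simp add: M1r_iff)
    ultimately have "(x, Y', z) \<in> D1" by (simp add: D1_iff)
    moreover have "qmap \<phi> = Psi1_bar (x, Y', z)"
    proof -
      have "Y' = Y + outer a z - 0 *\<^sub>R outer x z" by (simp add: Y'_def)
      then show ?thesis
        unfolding Psi1_bar_eq[OF M] \<phi> X
          qmap_rho_eq_iff[OF assms[unfolded \<phi> X] rho_outer_in_RR[OF M]]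
        by blast
    qed
    ultimately show ?thesis by blast
  next
    case True
    \<comment> \<open>The coefficient of the orthogonal projection of \<open>Y\<close> to
      \<open>X\<close>. For \<open>X = 0\<close> the division yields 0, and orthogonality is
      trivial.\<close>
    define c where "c = (X \<bullet> Y) / (X \<bullet> X)"
    define Y' where "Y' = Y - c *\<^sub>R X"
    have "X \<bullet> Y' = 0" by (cases "X = 0") (simp_all add: Y'_def c_def inner_diff_right)
    \<comment> \<open>Passing to \<open>Y'\<close> only shifts \<open>s\<close> by \<open>c\<close>,
      and nondegeneracy quantifies over all \<open>s\<close>.\<close>
    moreover have "Y' + s *\<^sub>R X = Y + (s - c) *\<^sub>R X" for s
      by (simp add: Y'_def algebra_simps)
    then have M: "(X, Y') \<in> M2r" using nd True by (simp add: M2r_iff nondegenerate_def)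
    ultimately have "(X, Y') \<in> D2" by (simp add: D2_iff)
    moreover have "qmap \<phi> = Psi2_bar (X, Y')"
    proof -
      have "Y' = Y + outer 0 0 - c *\<^sub>R X" by (simp add: Y'_def outer_def vec_eq_iff)
      then show ?thesis
        unfolding Psi2_bar_eq[OF M] \<phi> True
          qmap_rho_eq_iff[OF assms[unfolded \<phi> True] rho_0_in_RR[OF M]]
        by blast
    qed
    ultimately show ?thesis by blast
  qed
qed

theorem theorem5p1:
  shows "(D1 :: ((real ^ 'k) \<times> (real ^ 'k ^ 'k) \<times> (real ^ 'k::finite)) set) \<subseteq> M1r \<and>
    (D2 :: ((real ^ 'k ^ 'k) \<times> (real ^ 'k ^ 'k)) set) \<subseteq> M2r \<and>
    Psi1 ` (M1r :: ((real ^ 'k) \<times> (real ^ 'k ^ 'k) \<times> (real ^ 'k)) set) \<subseteq> ev ` RR \<and>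
    Psi2 ` (M2r :: ((real ^ 'k ^ 'k) \<times> (real ^ 'k ^ 'k)) set) \<subseteq> ev ` RR \<and>
    bij_betw (case_sum Psi1_bar Psi2_bar)
      ((D1 :: ((real ^ 'k) \<times> (real ^ 'k ^ 'k) \<times> (real ^ 'k)) set) <+> D2)
      (TT :: (int ^ 'k \<Rightarrow> 'k gmat) set set)"
proof (intro conjI)
  show D1: "(D1 :: ((real ^ 'k) \<times> (real ^ 'k ^ 'k) \<times> (real ^ 'k)) set) \<subseteq> M1r"
    by (auto simp: D1_iff)
  show D2: "(D2 :: ((real ^ 'k ^ 'k) \<times> (real ^ 'k ^ 'k)) set) \<subseteq> M2r"
    by (auto simp: D2_iff)
  show "Psi1 ` (M1r :: ((real ^ 'k) \<times> (real ^ 'k ^ 'k) \<times> (real ^ 'k)) set) \<subseteq> ev ` RR"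
    by (auto simp: Psi1_eq_ev_rho rho_outer_in_RR)
  show "Psi2 ` (M2r :: ((real ^ 'k ^ 'k) \<times> (real ^ 'k ^ 'k)) set) \<subseteq> ev ` RR"
    by (auto simp: Psi2_eq_ev_rho rho_0_in_RR)
  have TT_eq: "TT = qmap ` (RR :: (int ^ 'k \<Rightarrow> 'k gmat) set)"
    by (auto simp: TT_def quotient_def qmap_def)
  have "Psi1_bar p \<in> TT" if "p \<in> D1" for p :: "(real ^ 'k) \<times> (real ^ 'k ^ 'k) \<times> (real ^ 'k)"
    using that D1 by (cases p) (auto simp: TT_eq Psi1_bar_eq rho_outer_in_RR)
  moreover have "Psi2_bar p \<in> TT" if "p \<in> D2" for p :: "(real ^ 'k ^ 'k) \<times> (real ^ 'k ^ 'k)"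
    using that D2 by (cases p) (auto simp: TT_eq Psi2_bar_eq rho_0_in_RR)
  moreover have "TT \<subseteq> Psi1_bar ` (D1 :: ((real ^ 'k) \<times> (real ^ 'k ^ 'k) \<times> (real ^ 'k)) set)
      \<union> Psi2_bar ` D2"
    using qmap_in_image by (auto simp: TT_eq)
  ultimately have "Psi1_bar ` D1 \<union> Psi2_bar ` D2 = (TT :: (int ^ 'k \<Rightarrow> 'k gmat) set set)"
    by blast
  then have "case_sum Psi1_bar Psi2_bar ` (D1 <+> D2) = (TT :: (int ^ 'k \<Rightarrow> 'k gmat) set set)"
    by (simp add: Plus_def image_Un image_image)
  moreover have "inj_on (case_sum Psi1_bar Psi2_bar)
      ((D1 :: ((real ^ 'k) \<times> (real ^ 'k ^ 'k) \<times> (real ^ 'k)) set) <+> D2)"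
  proof (rule inj_onI)
    fix p q :: "(real ^ 'k) \<times> (real ^ 'k ^ 'k) \<times> (real ^ 'k) + (real ^ 'k ^ 'k) \<times> (real ^ 'k ^ 'k)"
    assume "p \<in> D1 <+> D2" "q \<in> D1 <+> D2"
      "case_sum Psi1_bar Psi2_bar p = case_sum Psi1_bar Psi2_bar q"
    then show "p = q"
      by (elim PlusE) (auto simp: Psi1_bar_neq_Psi2_bar Psi1_bar_neq_Psi2_bar[symmetric]
          dest: inj_onD[OF inj_on_Psi1_bar] inj_onD[OF inj_on_Psi2_bar])
  qed
  ultimately show "bij_betw (case_sum Psi1_bar Psi2_bar)
      ((D1 :: ((real ^ 'k) \<times> (real ^ 'k ^ 'k) \<times> (real ^ 'k)) set) <+> D2)
      (TT :: (int ^ 'k \<Rightarrow> 'k gmat) set set)"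
    by (simp add: bij_betw_def)
qed

end
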